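(* If $G$ is a strongly chordal graph, then $\gamma_f^\infty(G)\ge\gamma(G)$.
   Context: All graphs are finite, simple and undirected. A strongly chordal graph is a chordal graph in which every cycle of even length at least $6$ has a chord joining two vertices at odd distance greater than $1$ from each other along the cycle. $\gamma(G)$ is the domination number, the minimum cardinality of a set $X\subseteq V(G)$ with $\bigcup_{u\in X}N[u]=V(G)$. $N(v)$ is the open neighbourhood and $N[v]=N(v)\cup\{v\}$ the closed neighbourhood of $v$. A fractional dominating function of $G=(V,E)$ is a function $w:V\to[0,\infty)$ with $\sum_{x\in N[v]}w(x)\ge 1$ for all $v\in V$; its total weight is $\sum_{x\in V}w(x)$. Fractional eternal domination. Fix $S$. The defender chooses a fractional dominating function $w_1$ of total weight at most $S$. In each round $i\ge 1$ the attacker, who may choose attacks adaptively, attacks a vertex $v_i\in V$, and the defender chooses amounts $m_{xy,i}\ge 0$ for all $x\in V$, $y\in N(x)$, with $\sum_{y\in N(x)}m_{xy,i}\le w_i(x)$, and sets $w_{i+1}(x)=w_i(x)-\sum_{y\in N(x)}m_{xy,i}+\sum_{y\in N(x)}m_{yx,i}$. It is required that $w_{i+1}$ be a fractional dominating function and $w_{i+1}(v_i)\ge 1$. If the defender can respond in this way to every infinite sequence of attacks, $G$ can be eternally $S$-fractionally dominated. $\gamma_f^\infty(G)$ is the infimum of all $S$ for which $G$ can be eternally $S$-fractionally dominated. *)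

theory Defs
  imports Complex_Main "Graph_Theory.Pair_Digraph"
begin

text \<open>
  A finite simple undirected graph is a \<^locale>\<open>pair_graph\<close>: a finite, loopless, symmetric
  set of ordered pairs on a finite vertex set. The null graph is allowed.
\<close>

definition open_nbhd :: "'a pair_pre_digraph \<Rightarrow> 'a \<Rightarrow> 'a set" where
  "open_nbhd G v = {u. (v, u) \<in> parcs G}"

definition closed_nbhd :: "'a pair_pre_digraph \<Rightarrow> 'a \<Rightarrow> 'a set" where
  "closed_nbhd G v = insert v (open_nbhd G v)"

definition dominating_set :: "'a pair_pre_digraph \<Rightarrow> 'a set \<Rightarrow> bool" where
  "dominating_set G X \<longleftrightarrow> X \<subseteq> pverts G \<and> (\<Union>u\<in>X. closed_nbhd G u) = pverts G"

definition domination_number :: "'a pair_pre_digraph \<Rightarrow> nat" where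
  "domination_number G = Min (card ` {X. dominating_set G X})"


text \<open>Distance between positions \<open>i\<close> and \<open>j\<close> (both below \<open>n\<close>) along a cycle of length \<open>n\<close>.\<close>

definition cycle_dist :: "nat \<Rightarrow> nat \<Rightarrow> nat \<Rightarrow> nat" where
  "cycle_dist n i j = (let d = max i j - min i j in min d (n - d))"

text \<open>
  Cycles are lists of arcs; the \<open>i\<close>-th vertex of the cycle \<open>p\<close> is the tail \<open>fst (p ! i)\<close> of its
  \<open>i\<close>-th arc, and \<open>length p\<close> is the length of the cycle. The library also regards the closed walk
  \<open>a, b, a\<close> as a cycle, but only cycles of length at least 4 are considered below. A chord is an
  edge joining two vertices of the cycle whose distance \<open>d\<close> along the cycle exceeds 1.
\<close>

definition has_chord_at_dist :: "'a pair_pre_digraph \<Rightarrow> ('a \<times> 'a) list \<Rightarrow> nat \<Rightarrow> bool" where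
  "has_chord_at_dist G p d \<longleftrightarrow>
     d > 1 \<and> (\<exists>i < length p. \<exists>j < length p.
       cycle_dist (length p) i j = d \<and> (fst (p ! i), fst (p ! j)) \<in> parcs G)"

definition chordal :: "'a pair_pre_digraph \<Rightarrow> bool" where
  "chordal G \<longleftrightarrow>
     (\<forall>p. pre_digraph.cycle (with_proj G) p \<and> length p \<ge> 4 \<longrightarrow> (\<exists>d. has_chord_at_dist G p d))"

definition strongly_chordal :: "'a pair_pre_digraph \<Rightarrow> bool" where
  "strongly_chordal G \<longleftrightarrow> chordal G \<and>
     (\<forall>p. pre_digraph.cycle (with_proj G) p \<and> even (length p) \<and> length p \<ge> 6
        \<longrightarrow> (\<exists>d. odd d \<and> has_chord_at_dist G p d))"


text \<open>Weight functions are total; only their values on the vertex set matter.\<close>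

definition frac_dominating :: "'a pair_pre_digraph \<Rightarrow> ('a \<Rightarrow> real) \<Rightarrow> bool" where
  "frac_dominating G w \<longleftrightarrow>
     (\<forall>v\<in>pverts G. w v \<ge> 0) \<and> (\<forall>v\<in>pverts G. (\<Sum>x\<in>closed_nbhd G v. w x) \<ge> 1)"

definition total_weight :: "'a pair_pre_digraph \<Rightarrow> ('a \<Rightarrow> real) \<Rightarrow> real" where
  "total_weight G w = (\<Sum>x\<in>pverts G. w x)"

text \<open>In a move \<open>m\<close>, the amount sent from \<open>x\<close> to its neighbour \<open>y\<close> is \<open>m x y\<close>.\<close>

definition legal_move ::
    "'a pair_pre_digraph \<Rightarrow> ('a \<Rightarrow> real) \<Rightarrow> ('a \<Rightarrow> 'a \<Rightarrow> real) \<Rightarrow> bool" where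
  "legal_move G w m \<longleftrightarrow>
     (\<forall>x\<in>pverts G. (\<forall>y\<in>open_nbhd G x. m x y \<ge> 0) \<and> (\<Sum>y\<in>open_nbhd G x. m x y) \<le> w x)"

definition apply_move ::
    "'a pair_pre_digraph \<Rightarrow> ('a \<Rightarrow> real) \<Rightarrow> ('a \<Rightarrow> 'a \<Rightarrow> real) \<Rightarrow> 'a \<Rightarrow> real" where
  "apply_move G w m x = w x - (\<Sum>y\<in>open_nbhd G x. m x y) + (\<Sum>y\<in>open_nbhd G x. m y x)"

text \<open>
  Attacks may be chosen adaptively, so the defender's move may depend only on the attacks made so
  far: a strategy maps the nonempty list of attacks up to and including the current one to a move.
  Rounds are numbered from 0: \<open>play G w\<^sub>1 \<sigma> a i\<close> is the weight function before the attack \<open>a i\<close>.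
\<close>

primrec play ::
    "'a pair_pre_digraph \<Rightarrow> ('a \<Rightarrow> real) \<Rightarrow> ('a list \<Rightarrow> 'a \<Rightarrow> 'a \<Rightarrow> real) \<Rightarrow> (nat \<Rightarrow> 'a)
      \<Rightarrow> nat \<Rightarrow> 'a \<Rightarrow> real" where
  "play G w\<^sub>1 \<sigma> a 0 = w\<^sub>1"
| "play G w\<^sub>1 \<sigma> a (Suc i) = apply_move G (play G w\<^sub>1 \<sigma> a i) (\<sigma> (map a [0..<Suc i]))"

definition eternally_frac_dominated :: "'a pair_pre_digraph \<Rightarrow> real \<Rightarrow> bool" where
  "eternally_frac_dominated G S \<longleftrightarrow>
     (\<exists>w\<^sub>1 \<sigma>. frac_dominating G w\<^sub>1 \<and> total_weight G w\<^sub>1 \<le> S \<and>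
        (\<forall>a. range a \<subseteq> pverts G \<longrightarrow>
           (\<forall>i. legal_move G (play G w\<^sub>1 \<sigma> a i) (\<sigma> (map a [0..<Suc i])) \<and>
                frac_dominating G (play G w\<^sub>1 \<sigma> a (Suc i)) \<and>
                play G w\<^sub>1 \<sigma> a (Suc i) (a i) \<ge> 1)))"

definition frac_eternal_domination_number :: "'a pair_pre_digraph \<Rightarrow> real" where
  "frac_eternal_domination_number G = Inf {S. eternally_frac_dominated G S}"


text \<open>The minimum and the infimum above are genuine: both range over nonempty sets, the first
  finite and the second bounded below.\<close>

lemma (in pair_graph) dominating_sets:
  "finite {X. dominating_set G X}" "{X. dominating_set G X} \<noteq> {}"
proof -
  show "finite {X. dominating_set G X}"
    by (rule finite_subset[of _ "Pow (pverts G)"]) (auto simp: dominating_set_def pair_finite_verts)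
  have "dominating_set G (pverts G)"
    by (auto simp: dominating_set_def closed_nbhd_def open_nbhd_def dest: in_arcsD2)
  then show "{X. dominating_set G X} \<noteq> {}" by blast
qed

lemma (in pair_graph) eternally_frac_dominated_set:
  "{S. eternally_frac_dominated G S} \<noteq> {}" "bdd_below {S. eternally_frac_dominated G S}"
proof -
  have fin: "finite (closed_nbhd G v)" if "v \<in> pverts G" for v
    by (rule finite_subset[OF _ pair_finite_verts])
      (use that in \<open>auto simp: closed_nbhd_def open_nbhd_def dest: in_arcsD2\<close>)
  have fd: "frac_dominating G (\<lambda>_. 1)"
  proof -
    have "card (closed_nbhd G v) \<ge> 1" if "v \<in> pverts G" for v
      using fin[OF that] by (auto simp: Suc_le_eq card_gt_0_iff closed_nbhd_def)
    then show ?thesis by (auto simp: frac_dominating_def)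
  qed
  have pl: "play G (\<lambda>_. 1) (\<lambda>_ _ _. 0) a i = (\<lambda>_. 1)" for a i
    by (induction i) (auto simp: apply_move_def)
  have "eternally_frac_dominated G (total_weight G (\<lambda>_. 1))"
    unfolding eternally_frac_dominated_def
    by (rule exI[of _ "\<lambda>_. 1"], rule exI[of _ "\<lambda>_ _ _. 0"])
      (simp add: pl fd legal_move_def del: play.simps)
  then show "{S. eternally_frac_dominated G S} \<noteq> {}" by blast
  show "bdd_below {S. eternally_frac_dominated G S}"
  proof (rule bdd_belowI[of _ 0])
    fix S assume "S \<in> {S. eternally_frac_dominated G S}"
    then obtain w where "frac_dominating G w" "total_weight G w \<le> S"
      by (auto simp: eternally_frac_dominated_def)
    moreover from this have "total_weight G w \<ge> 0"
      by (auto simp: total_weight_def frac_dominating_def intro: sum_nonneg)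
    ultimately show "0 \<le> S" by simp
  qed
qed

end

theory Submission
  imports Defs
begin

text \<open>
  Already the first weight function of the defender is a fractional dominating function, so it
  suffices that every fractional dominating function of a strongly chordal graph has total weight
  at least \<open>\<gamma>(G)\<close>. This follows from Farber's duality: such a graph has a set \<open>P\<close> of at
  least \<open>\<gamma>(G)\<close> vertices whose closed neighbourhoods are pairwise disjoint, and each of these neighbourhoods
  carries weight at least 1 (\<open>domination_number_le_packing\<close>, \<open>packing_le_total_weight\<close>).

  The packing comes from an ordering of the vertices in which the closed neighbourhood matrix has
  no submatrix with rows 11 and 10 (\<open>greedy_order\<close>). With such an ordering a greedy algorithm
  works: take the first vertex \<open>u\<close> not yet dominated, put \<open>u\<close> into the packing and the last vertex
  \<open>c\<close> of \<open>N[u]\<close> into the dominating set. Any later vertex whose neighbourhood meets \<open>N[u]\<close> is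
  adjacent or equal to \<open>c\<close>, hence dominated at once (\<open>greedy_packing\<close>).

  The ordering is chosen to maximise \<open>\<Sum> 2 ^ (pos x + pos y)\<close> over all pairs \<open>x, y\<close> that are
  adjacent or equal. Exchanging two vertices shows that at a maximum the rows, read as binary
  numbers, are increasing (\<open>lexical_order\<close>). If a forbidden submatrix occurred, this lexical
  order would supply, for two consecutive rows or columns that are out of order at one place, a
  later place that makes up for it. The forbidden pattern thus grows by one row and one column at
  a time (\<open>ladder_extend\<close>). The graph being finite, the growth stops, which is only possible if a
  special cycle closes up: an induced cycle of length at least 6 in the bipartite graph between
  rows and columns.

  A strongly chordal graph has no special cycle (\<open>strongly_chordal_no_special_cycle\<close>). If the
  vertices on it are distinct, it is an even cycle of \<open>G\<close> without odd chords. Otherwise a row and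
  the next column are the same vertex \<open>v\<close>; then the rest of the special cycle leads from one
  neighbour of \<open>v\<close> to a nonadjacent one while avoiding \<open>N[v]\<close>, which chordality forbids
  (\<open>chordal_walk_around\<close>).
\<close>

section \<open>Lexical orderings of symmetric matrices\<close>

text \<open>The order of binary numbers is decided by the highest digit at which they differ.\<close>

lemma binary_value_compare:
  fixes pos :: "'a \<Rightarrow> nat"
  assumes fin: "finite A" "finite B" and inj: "inj_on pos (A \<union> B)"
    and le: "(\<Sum>x\<in>A. 2 ^ pos x :: int) \<le> (\<Sum>x\<in>B. 2 ^ pos x)" and b: "b \<in> A" "b \<notin> B"
  obtains c where "c \<in> B" "c \<notin> A" "pos b < pos c"
    "\<And>d. d \<in> A \<union> B \<Longrightarrow> pos c < pos d \<Longrightarrow> d \<in> A \<longleftrightarrow> d \<in> B"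
proof -
  define D where "D = (A - B) \<union> (B - A)"
  have "finite D" "b \<in> D" using fin b by (auto simp: D_def)
  then have "Max (pos ` D) \<in> pos ` D" by (intro Max_in) auto
  then obtain c where c: "c \<in> D" "pos c = Max (pos ` D)" by auto
  have top: "pos d \<le> pos c" if "d \<in> D" for d
    using that \<open>finite D\<close> c(2) by simp
  have "c \<notin> A - B"
  proof
    assume cA: "c \<in> A - B"
    have less: "pos d < pos c" if "d \<in> B - A" for d
      using top[of d] inj_onD[OF inj, of d c] that cA by (force simp: D_def le_less)
    \<comment> \<open>all elements of \<open>B - A\<close> together weigh less than \<open>c\<close> alone\<close>
    have "(\<Sum>x\<in>B - A. 2 ^ pos x :: int) = (\<Sum>k\<in>pos ` (B - A). 2 ^ k)"
      by (subst sum.reindex) (auto intro: inj_on_subset[OF inj])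
    also have "\<dots> \<le> (\<Sum>k<pos c. 2 ^ k)"
      using less by (intro sum_mono2) auto
    also have "\<dots> < 2 ^ pos c"
      by (simp flip: mask_eq_sum_exp add: lessThan_def)
    also have "\<dots> \<le> (\<Sum>x\<in>A - B. 2 ^ pos x)"
      using cA fin by (intro member_le_sum) auto
    finally have "(\<Sum>x\<in>B - A. 2 ^ pos x :: int) < (\<Sum>x\<in>A - B. 2 ^ pos x)" .
    moreover have "(\<Sum>x\<in>A. 2 ^ pos x :: int) = (\<Sum>x\<in>A - B. 2 ^ pos x) + (\<Sum>x\<in>A \<inter> B. 2 ^ pos x)"
      "(\<Sum>x\<in>B. 2 ^ pos x :: int) = (\<Sum>x\<in>B - A. 2 ^ pos x) + (\<Sum>x\<in>A \<inter> B. 2 ^ pos x)"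
      using sum.Int_Diff[OF fin(1), of _ B] sum.Int_Diff[OF fin(2), of _ A]
      by (simp_all add: Int_commute add.commute)
    ultimately show False using le by simp
  qed
  moreover from this have "pos b < pos c"
    using top[OF \<open>b \<in> D\<close>] inj_onD[OF inj, of b c] c(1) b by (force simp: D_def le_less)
  moreover have "d \<in> A \<longleftrightarrow> d \<in> B" if "d \<in> A \<union> B" "pos c < pos d" for d
    using that top[of d] by (auto simp: D_def)
  ultimately show thesis using that c(1) by (auto simp: D_def)
qed

text \<open>The relation stands for adjacency or equality in a graph, that is, for the closed
  neighbourhood matrix.\<close>

locale tolerance =
  fixes V :: "'a set" and R :: "'a \<Rightarrow> 'a \<Rightarrow> bool"
  assumes finite_V: "finite V" and rel_refl: "R x x" and rel_sym: "R x y \<Longrightarrow> R y x"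
begin

text \<open>
  Exchanging the values at \<open>u\<close> and \<open>v\<close> adds \<open>d\<close> times the vector \<open>s = 1\<^sub>u - 1\<^sub>v\<close> to \<open>e\<close>. The
  quadratic form then grows by \<open>2 * d * (S u - S v)\<close>, with \<open>S\<close> the row sums, plus \<open>d\<^sup>2\<close> times its
  value at \<open>s\<close>, which is \<open>2 - 2 * r u v\<close> and so cannot be negative.
\<close>

lemma quadratic_form_transpose:
  fixes e :: "'a \<Rightarrow> int"
  defines "r \<equiv> \<lambda>x y. of_bool (R x y)"
  assumes uv: "u \<in> V" "v \<in> V" and less: "e u < e v"
    and max: "(\<Sum>x\<in>V. \<Sum>y\<in>V. r x y * (e(u := e v, v := e u)) x * (e(u := e v, v := e u)) y)
      \<le> (\<Sum>x\<in>V. \<Sum>y\<in>V. r x y * e x * e y)"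
  shows "(\<Sum>y\<in>V. r u y * e y) \<le> (\<Sum>y\<in>V. r v y * e y)"
proof -
  define d where "d = e v - e u"
  define s :: "'a \<Rightarrow> int" where "s x = of_bool (x = u) - of_bool (x = v)" for x
  define S where "S x = (\<Sum>y\<in>V. r x y * e y)" for x
  have e': "(e(u := e v, v := e u)) x = e x + d * s x" for x
    using less by (auto simp: d_def s_def)
  have rsym: "r x y = r y x" for x y using rel_sym by (auto simp: r_def)
  have sumr: "(\<Sum>x\<in>V. s x * f x) = f u - f v" for f :: "'a \<Rightarrow> int"
  proof -
    have "(\<Sum>x\<in>V. s x * f x) = (\<Sum>x\<in>V. (if x = u then f x else 0) - (if x = v then f x else 0))"
      by (rule sum.cong) (auto simp: s_def)
    then show ?thesis using uv finite_V by (simp add: sum_subtractf)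
  qed
  have m1: "(\<Sum>x\<in>V. \<Sum>y\<in>V. r x y * s x * e y) = S u - S v"
    unfolding sumr[symmetric, of S] unfolding S_def sum_distrib_left by (intro sum.cong) auto
  have m2: "(\<Sum>x\<in>V. \<Sum>y\<in>V. r x y * e x * s y) = S u - S v"
    unfolding m1[symmetric] by (subst sum.swap, intro sum.cong refl) (subst rsym, simp)
  have "(\<Sum>x\<in>V. \<Sum>y\<in>V. r x y * s x * s y) = (\<Sum>x\<in>V. s x * (\<Sum>y\<in>V. s y * r x y))"
    unfolding sum_distrib_left by (intro sum.cong) auto
  also have "\<dots> = 2 - 2 * r u v"
    unfolding sumr using rsym[of u v] by (simp add: r_def rel_refl)
  finally have m3: "(\<Sum>x\<in>V. \<Sum>y\<in>V. r x y * s x * s y) \<ge> 0" by (simp add: r_def)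
  have "(\<Sum>x\<in>V. \<Sum>y\<in>V. r x y * (e x + d * s x) * (e y + d * s y))
      = (\<Sum>x\<in>V. \<Sum>y\<in>V. r x y * e x * e y) + d * (\<Sum>x\<in>V. \<Sum>y\<in>V. r x y * s x * e y)
      + d * (\<Sum>x\<in>V. \<Sum>y\<in>V. r x y * e x * s y) + d\<^sup>2 * (\<Sum>x\<in>V. \<Sum>y\<in>V. r x y * s x * s y)"
    unfolding sum_distrib_left sum.distrib[symmetric]
    by (intro sum.cong refl) (simp add: algebra_simps power2_eq_square)
  then have "2 * (d * (S u - S v)) + d\<^sup>2 * (\<Sum>x\<in>V. \<Sum>y\<in>V. r x y * s x * s y) \<le> 0"
    using max unfolding e' m1 m2 by simp
  moreover have "d\<^sup>2 * (\<Sum>x\<in>V. \<Sum>y\<in>V. r x y * s x * s y) \<ge> 0" using m3 by simp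
  ultimately have "d * (S u - S v) \<le> 0" by linarith
  then show ?thesis using less unfolding S_def d_def by (simp add: mult_le_0_iff)
qed

text \<open>
  At an ordering that maximises the quadratic form at the vector with entries \<open>2 ^ pos x\<close>, the
  preceding lemma says that the rows of the matrix, read as binary numbers, are increasing. Since rows and columns
  carry the same ordering and the matrix is symmetric, the columns are increasing as well.
\<close>

lemma lexical_order:
  obtains pos :: "'a \<Rightarrow> nat" where "inj_on pos V" "pos ` V \<subseteq> {..<card V}"
    "\<And>u v b. u \<in> V \<Longrightarrow> v \<in> V \<Longrightarrow> b \<in> V \<Longrightarrow> pos u < pos v \<Longrightarrow> R u b \<Longrightarrow> \<not> R v b \<Longrightarrow>
      \<exists>c\<in>V. pos b < pos c \<and> R v c \<and> \<not> R u c \<and> (\<forall>d\<in>V. pos c < pos d \<longrightarrow> R u d = R v d)"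
proof -
  define r :: "'a \<Rightarrow> 'a \<Rightarrow> int" where "r x y = of_bool (R x y)" for x y
  define Q where "Q e = (\<Sum>x\<in>V. \<Sum>y\<in>V. r x y * e x * e y)" for e
  define E :: "('a \<Rightarrow> nat) \<Rightarrow> 'a \<Rightarrow> int" where "E pos x = 2 ^ pos x" for pos x
  define P where "P pos \<longleftrightarrow> inj_on pos V \<and> pos ` V \<subseteq> {..<card V}" for pos :: "'a \<Rightarrow> nat"
  have Q0: "Q (E pos) \<ge> 0" for pos
    by (auto simp: Q_def E_def r_def intro!: sum_nonneg)
  obtain pos0 where "P pos0"
    using ex_bij_betw_finite_nat[OF finite_V] by (auto simp: P_def bij_betw_def lessThan_atLeast0)
  \<comment> \<open>a bound on the quadratic form, so that a maximum exists\<close>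
  moreover have "nat (Q (E pos)) < Suc (nat (\<Sum>x\<in>V. \<Sum>y\<in>V. 1 * 2 ^ card V * 2 ^ card V))" if "P pos" for pos
  proof (intro le_imp_less_Suc nat_mono, unfold Q_def, intro sum_mono mult_mono)
    show "E pos x \<le> 2 ^ card V" if "x \<in> V" for x
      using \<open>P pos\<close> that by (force simp: E_def P_def)
    then show "E pos x \<le> 2 ^ card V" if "x \<in> V" for x using that .
  qed (auto simp: r_def E_def)
  ultimately obtain pos where pos: "P pos" and "\<And>pos'. P pos' \<Longrightarrow> nat (Q (E pos')) \<le> nat (Q (E pos))"
    using ex_has_greatest_nat[of P pos0 "\<lambda>pos. nat (Q (E pos))"] by metis
  then have max: "\<And>pos'. P pos' \<Longrightarrow> Q (E pos') \<le> Q (E pos)"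
    using Q0 by (simp add: nat_le_eq_zle)
  have le: "(\<Sum>y\<in>{y\<in>V. R u y}. 2 ^ pos y :: int) \<le> (\<Sum>y\<in>{y\<in>V. R v y}. 2 ^ pos y)"
    if uv: "u \<in> V" "v \<in> V" "pos u < pos v" for u v
  proof -
    have inj: "\<And>x y. x \<in> V \<Longrightarrow> y \<in> V \<Longrightarrow> pos x = pos y \<longleftrightarrow> x = y"
      using pos by (auto simp: P_def dest: inj_onD)
    have "inj_on (pos(u := pos v, v := pos u)) V"
      by (rule inj_onI) (simp add: inj uv split: if_splits)
    then have "P (pos(u := pos v, v := pos u))"
      using pos uv by (auto simp: P_def)
    moreover have "E (pos(u := pos v, v := pos u)) = (E pos)(u := E pos v, v := E pos u)"
      by (rule ext) (simp add: E_def)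
    ultimately have "Q ((E pos)(u := E pos v, v := E pos u)) \<le> Q (E pos)"
      using max by metis
    moreover have "E pos u < E pos v" using uv(3) by (simp add: E_def)
    ultimately have "(\<Sum>y\<in>V. r u y * E pos y) \<le> (\<Sum>y\<in>V. r v y * E pos y)"
      using quadratic_form_transpose[OF uv(1,2), of "E pos"] unfolding Q_def r_def by blast
    then show ?thesis
      by (simp add: r_def E_def sum.inter_filter[OF finite_V] of_bool_def if_distrib if_distribR cong: if_cong)
  qed
  show thesis
  proof (rule that)
    fix u v b assume *: "u \<in> V" "v \<in> V" "b \<in> V" "pos u < pos v" "R u b" "\<not> R v b"
    have "inj_on pos ({y\<in>V. R u y} \<union> {y\<in>V. R v y})"
      using pos by (auto simp: P_def inj_on_def)
    then obtain c where c: "c \<in> {y\<in>V. R v y}" "c \<notin> {y\<in>V. R u y}" "pos b < pos c"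
      "\<And>d. d \<in> {y\<in>V. R u y} \<union> {y\<in>V. R v y} \<Longrightarrow> pos c < pos d \<Longrightarrow>
        d \<in> {y\<in>V. R u y} \<longleftrightarrow> d \<in> {y\<in>V. R v y}"
      by (rule binary_value_compare[rotated 2, OF _ le[OF *(1,2,4)], of b]) (use finite_V * in auto)
    then show "\<exists>c\<in>V. pos b < pos c \<and> R v c \<and> \<not> R u c \<and> (\<forall>d\<in>V. pos c < pos d \<longrightarrow> R u d = R v d)"
      by (intro bexI[of _ c]) auto
  qed (use pos in \<open>auto simp: P_def\<close>)
qed

end

section \<open>Special cycles from forbidden submatrices\<close>

text \<open>
  The entries of \<open>z\<close> are alternately rows and columns of the matrix \<open>R\<close>; only pairs at odd distance
  are constrained, and the same vertex may occur once as a row and once as a column. The sequence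
  is extended periodically so that the condition is invariant under shifts and needs no case
  distinction for distances that pass the end of the cycle.
\<close>

definition special_cycle :: "('a \<Rightarrow> 'a \<Rightarrow> bool) \<Rightarrow> nat \<Rightarrow> (nat \<Rightarrow> 'a) \<Rightarrow> bool" where
  "special_cycle R n z \<longleftrightarrow> even n \<and> 6 \<le> n \<and> (\<forall>s. z (s + n) = z s) \<and>
     (\<forall>s d. odd d \<longrightarrow> d < n \<longrightarrow> R (z s) (z (s + d)) \<longleftrightarrow> d = 1 \<or> d = n - 1)"

text \<open>
  The assumption describes two paths \<open>i 0, j 1, i 2, \<dots>\<close> and \<open>j 0, i 1, j 2, \<dots>\<close>, joined at their
  first and at their last members and without further adjacencies between rows and columns.
  Walking up the first path and down the second gives the cycle.
\<close>

lemma special_cycle_of_ladder: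
  fixes i j :: "nat \<Rightarrow> 'a"
  assumes sym: "\<And>x y. R x y \<Longrightarrow> R y x" and k: "3 \<le> k"
    and R: "\<And>a b. a < k \<Longrightarrow> b < k \<Longrightarrow>
      R (i a) (j b) \<longleftrightarrow> a = 0 \<and> b = 0 \<or> a = Suc b \<or> b = Suc a \<or> a = k - 1 \<and> b = k - 1"
  shows "\<exists>n z. special_cycle R n z"
proof -
  define z where "z t = (if t < k then if even t then i t else j t
    else if even t then i (2 * k - 1 - t) else j (2 * k - 1 - t))" for t
  \<comment> \<open>the position of the \<open>t\<close>-th member on its path: upwards first, then downwards\<close>
  define p where "p t = (if t < k then t else 2 * k - 1 - t)" for t
  have z: "z t = (if even t then i (p t) else j (p t))" for t by (auto simp: z_def p_def)
  have one: "R (z s) (z t) \<longleftrightarrow> t = Suc s \<or> s = Suc t \<or> s = 0 \<and> t = 2 * k - 1"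
    if "s < 2 * k" "t < 2 * k" "even s" "odd t" for s t
  proof -
    have "p s < k" "p t < k" using that k by (auto simp: p_def)
    then have "R (z s) (z t) \<longleftrightarrow> p s = 0 \<and> p t = 0 \<or> p s = Suc (p t) \<or> p t = Suc (p s) \<or> p s = k - 1 \<and> p t = k - 1"
      using R that by (simp add: z)
    also have "\<dots> \<longleftrightarrow> t = Suc s \<or> s = Suc t \<or> s = 0 \<and> t = 2 * k - 1"
    proof -
      have ne: "s \<noteq> t" using that by auto
      show ?thesis
      proof (cases "s < k"; cases "t < k")
        assume *: "s < k" "\<not> t < k"
        define y where "y = 2 * k - 1 - t"
        have y: "y + t + 1 = 2 * k" using that by (simp add: y_def)
        then have "even y" using \<open>odd t\<close> by presburger
        then have "s \<noteq> Suc y" "y \<noteq> Suc s" using \<open>even s\<close> by auto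
        then show ?thesis using y * k unfolding p_def by auto
      next
        assume *: "\<not> s < k" "t < k"
        define x where "x = 2 * k - 1 - s"
        have x: "x + s + 1 = 2 * k" using that by (simp add: x_def)
        then have "odd x" using \<open>even s\<close> by presburger
        then have "x \<noteq> Suc t" "t \<noteq> Suc x" "x \<noteq> 0" using \<open>odd t\<close> by (auto elim: oddE)
        then show ?thesis using x * k unfolding p_def by auto
      qed (use ne that k in \<open>auto simp: p_def\<close>)
    qed
    finally show ?thesis .
  qed
  have two: "R (z s) (z t) \<longleftrightarrow> t = Suc s \<or> s = Suc t \<or> s = 0 \<and> t = 2 * k - 1 \<or> t = 0 \<and> s = 2 * k - 1"
    if "s < 2 * k" "t < 2 * k" "even s \<noteq> even t" for s t
  proof (cases "even s")
    case True
    then show ?thesis using one[of s t] that k by auto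
  next
    case False
    then have "R (z s) (z t) \<longleftrightarrow> R (z t) (z s)" using sym by blast
    then show ?thesis using one[of t s] that k False by auto
  qed
  have "special_cycle R (2 * k) (\<lambda>t. z (t mod (2 * k)))"
    unfolding special_cycle_def
  proof (intro conjI allI impI)
    fix s d :: nat assume d: "odd d" "d < 2 * k"
    define m where "m = s mod (2 * k)"
    have m: "m < 2 * k" using k by (simp add: m_def)
    have "(s + d) mod (2 * k) = (m + d) mod (2 * k)" by (simp add: m_def mod_add_left_eq)
    also have "\<dots> = (if m + d < 2 * k then m + d else m + d - 2 * k)"
      using m d by (simp add: mod_if)
    finally have sd: "(s + d) mod (2 * k) = (if m + d < 2 * k then m + d else m + d - 2 * k)" .
    show "R (z (s mod (2 * k))) (z ((s + d) mod (2 * k))) \<longleftrightarrow> d = 1 \<or> d = 2 * k - 1"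
      unfolding sd m_def[symmetric] using m d k
      by (cases "m + d < 2 * k"; simp; subst two) auto
  qed (use k in auto)
  then show ?thesis by blast
qed

lemma all_less_two: "(\<forall>a<2. Q a) \<longleftrightarrow> Q 0 \<and> Q (Suc 0)" for Q :: "nat \<Rightarrow> bool"
  by (auto simp: less_2_cases_iff)

context tolerance
begin

text \<open>
  A growing trace of a lexical ordering that is not greedy: rows \<open>i\<close> and columns \<open>j\<close> whose incidences
  are those of two disjoint paths joined at their first members only, the case \<open>k = 2\<close> being the
  forbidden submatrix with rows 11 and 10. The last two clauses make it extendable: a column added
  beyond \<open>j (k - 1)\<close> meets either all or none of the rows \<open>i 0, \<dots>, i (k - 2)\<close>, and likewise for
  an added row.
\<close>

definition ladder :: "('a \<Rightarrow> nat) \<Rightarrow> nat \<Rightarrow> (nat \<Rightarrow> 'a) \<Rightarrow> (nat \<Rightarrow> 'a) \<Rightarrow> bool" where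
  "ladder pos k i j \<longleftrightarrow> (\<forall>a<k. i a \<in> V \<and> j a \<in> V) \<and>
     (\<forall>a. Suc a < k \<longrightarrow> pos (i a) < pos (i (Suc a)) \<and> pos (j a) < pos (j (Suc a))) \<and>
     (\<forall>a<k. \<forall>b<k. R (i a) (j b) \<longleftrightarrow> a = 0 \<and> b = 0 \<or> a = Suc b \<or> b = Suc a) \<and>
     (\<forall>a. Suc a < k \<longrightarrow> (\<forall>d\<in>V. pos (j (k - 1)) < pos d \<longrightarrow> R (i a) d = R (i 0) d)) \<and>
     (\<forall>a. Suc a < k \<longrightarrow> (\<forall>d\<in>V. pos (i (k - 1)) < pos d \<longrightarrow> R (j a) d = R (j 0) d))"

text \<open>
  The last two rows agree with the lexical order although the earlier of them has an entry in column
  \<open>j (k - 1)\<close> that the later one lacks. So there is a last column at which they differ, it lies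
  further on, and it meets the later row only. Symmetrically there is a new row. If the new row
  and the new column are incident, the two paths close to a special cycle; otherwise they form a
  longer ladder.
\<close>

lemma ladder_extend:
  fixes pos :: "'a \<Rightarrow> nat"
  assumes lex: "\<And>u v b. u \<in> V \<Longrightarrow> v \<in> V \<Longrightarrow> b \<in> V \<Longrightarrow> pos u < pos v \<Longrightarrow> R u b \<Longrightarrow> \<not> R v b \<Longrightarrow>
      \<exists>c\<in>V. pos b < pos c \<and> R v c \<and> \<not> R u c \<and> (\<forall>d\<in>V. pos c < pos d \<longrightarrow> R u d = R v d)"
    and nosp: "\<nexists>n z. special_cycle R n z"
    and k: "2 \<le> k" and lad: "ladder pos k i j"
  shows "\<exists>i j. ladder pos (Suc k) i j"
proof -
  obtain q where q: "k = Suc (Suc q)" using k that[of "k - 2"] by simp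
  have V: "i a \<in> V" "j a \<in> V" if "a < k" for a
    using lad that by (simp_all add: ladder_def)
  have inc: "pos (i a) < pos (i (Suc a))" "pos (j a) < pos (j (Suc a))" if "Suc a < k" for a
    using lad that by (simp_all add: ladder_def)
  have R: "R (i a) (j b) \<longleftrightarrow> a = 0 \<and> b = 0 \<or> a = Suc b \<or> b = Suc a" if "a < k" "b < k" for a b
    using lad that by (simp add: ladder_def)
  have "\<forall>a. Suc a < k \<longrightarrow> (\<forall>d\<in>V. pos (j (k - 1)) < pos d \<longrightarrow> R (i a) d = R (i 0) d)"
    using lad unfolding ladder_def by blast
  then have agi: "R (i a) d = R (i 0) d" if "a \<le> q" "d \<in> V" "pos (j (Suc q)) < pos d" for a d
    using that q by (metis Suc_le_lessD diff_Suc_1 Suc_le_mono)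
  have "\<forall>a. Suc a < k \<longrightarrow> (\<forall>d\<in>V. pos (i (k - 1)) < pos d \<longrightarrow> R (j a) d = R (j 0) d)"
    using lad unfolding ladder_def by blast
  then have agj: "R (j a) d = R (j 0) d" if "a \<le> q" "d \<in> V" "pos (i (Suc q)) < pos d" for a d
    using that q by (metis Suc_le_lessD diff_Suc_1 Suc_le_mono)
  obtain c where c: "c \<in> V" "pos (j (Suc q)) < pos c" "R (i (Suc q)) c" "\<not> R (i q) c"
    "\<And>d. d \<in> V \<Longrightarrow> pos c < pos d \<Longrightarrow> R (i q) d = R (i (Suc q)) d"
    using lex[of "i q" "i (Suc q)" "j (Suc q)"] V[of q] V[of "Suc q"] inc[of q]
      R[of q "Suc q"] R[of "Suc q" "Suc q"] q by auto
  have "R (j q) (i (Suc q))" "\<not> R (j (Suc q)) (i (Suc q))"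
    using R[of "Suc q" q] R[of "Suc q" "Suc q"] rel_sym[of "i (Suc q)"] rel_sym[of "j (Suc q)"] q
    by auto
  then obtain r where r: "r \<in> V" "pos (i (Suc q)) < pos r" "R (j (Suc q)) r" "\<not> R (j q) r"
    "\<And>d. d \<in> V \<Longrightarrow> pos r < pos d \<Longrightarrow> R (j q) d = R (j (Suc q)) d"
    using lex[of "j q" "j (Suc q)" "i (Suc q)"] V[of q] V[of "Suc q"] inc[of q] q by auto
  define i' where "i' = i(k := r)"
  define j' where "j' = j(k := c)"
  \<comment> \<open>the rows before the last agree beyond \<open>j (k - 1)\<close>, so like row \<open>i q\<close> none of them meets \<open>c\<close>\<close>
  have ic: "R (i a) c \<longleftrightarrow> a = Suc q" if "a < k" for a
    using agi[of a c] agi[of q c] c(1-4) that q by (cases "a = Suc q") (auto simp: less_Suc_eq_le)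
  have rj: "R r (j b) \<longleftrightarrow> b = Suc q" if "b < k" for b
    using agj[of b r] agj[of q r] r(1-4) that q rel_sym[of r "j b"] rel_sym[of "j b" r]
    by (cases "b = Suc q") (auto simp: less_Suc_eq_le)
  have R': "R (i' a) (j' b) \<longleftrightarrow> a = 0 \<and> b = 0 \<or> a = Suc b \<or> b = Suc a"
    if "a < Suc k" "b < Suc k" "\<not> (a = k \<and> b = k)" for a b
    using that R[of a b] ic[of a] rj[of b] q
    by (cases "a = k"; cases "b = k") (simp_all add: i'_def j'_def, auto)
  have corner: "\<not> R r c"
  proof
    assume rc: "R r c"
    have "\<exists>n z. special_cycle R n z"
    proof (rule special_cycle_of_ladder[OF rel_sym])
      show "3 \<le> Suc k" using k by simp
      fix a b assume ab: "a < Suc k" "b < Suc k"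
      show "R (i' a) (j' b) \<longleftrightarrow> a = 0 \<and> b = 0 \<or> a = Suc b \<or> b = Suc a \<or> a = Suc k - 1 \<and> b = Suc k - 1"
      proof (cases "a = k \<and> b = k")
        case True
        then show ?thesis using rc by (simp add: i'_def j'_def)
      next
        case False
        then show ?thesis using R'[OF ab] by auto
      qed
    qed
    then show False using nosp by blast
  qed
  have "ladder pos (Suc k) i' j'"
    unfolding ladder_def
  proof (intro conjI allI impI ballI)
    fix a b assume "a < Suc k" "b < Suc k"
    then show "R (i' a) (j' b) \<longleftrightarrow> a = 0 \<and> b = 0 \<or> a = Suc b \<or> b = Suc a"
      using R'[of a b] corner q by (cases "a = k \<and> b = k") (auto simp: i'_def j'_def)
  next
    fix a d assume *: "Suc a < Suc k" "d \<in> V" "pos (j' (Suc k - 1)) < pos d"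
    then have d: "pos c < pos d" by (simp add: j'_def)
    then have "R (i a) d = R (i 0) d"
      using agi[of a d] agi[of q d] c(2) c(5)[of d] * q
      by (cases "a = Suc q") (auto simp: less_Suc_eq_le)
    then show "R (i' a) d = R (i' 0) d" using * q by (simp add: i'_def)
  next
    fix a d assume *: "Suc a < Suc k" "d \<in> V" "pos (i' (Suc k - 1)) < pos d"
    then have d: "pos r < pos d" by (simp add: i'_def)
    then have "R (j a) d = R (j 0) d"
      using agj[of a d] agj[of q d] r(2) r(5)[of d] * q
      by (cases "a = Suc q") (auto simp: less_Suc_eq_le)
    then show "R (j' a) d = R (j' 0) d" using * q by (simp add: j'_def)
  next
    fix a assume "a < Suc k"
    then show "i' a \<in> V" "j' a \<in> V" using V[of a] c(1) r(1) by (auto simp: i'_def j'_def)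
  next
    fix a assume "Suc a < Suc k"
    then show "pos (i' a) < pos (i' (Suc a))" "pos (j' a) < pos (j' (Suc a))"
      using inc[of a] c(2) r(2) q by (auto simp: i'_def j'_def)
  qed
  then show ?thesis by blast
qed

text \<open>
  A violation is a ladder of length 2, which extends to ladders of every length. The positions of
  their rows increase, but there are only as many positions as vertices.
\<close>

lemma greedy_order:
  assumes nosp: "\<nexists>n z. special_cycle R n z"
  obtains pos :: "'a \<Rightarrow> nat" where "inj_on pos V"
    "\<And>u v b c. \<lbrakk>u \<in> V; v \<in> V; b \<in> V; c \<in> V; pos u < pos v; pos b < pos c; R u b; R u c; R v b\<rbrakk> \<Longrightarrow> R v c"
proof -
  obtain pos :: "'a \<Rightarrow> nat" where inj: "inj_on pos V" and rng: "pos ` V \<subseteq> {..<card V}" and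
    lex: "\<And>u v b. u \<in> V \<Longrightarrow> v \<in> V \<Longrightarrow> b \<in> V \<Longrightarrow> pos u < pos v \<Longrightarrow> R u b \<Longrightarrow> \<not> R v b \<Longrightarrow>
      \<exists>c\<in>V. pos b < pos c \<and> R v c \<and> \<not> R u c \<and> (\<forall>d\<in>V. pos c < pos d \<longrightarrow> R u d = R v d)"
    using lexical_order by blast
  have "R v c" if *: "u \<in> V" "v \<in> V" "b \<in> V" "c \<in> V" "pos u < pos v" "pos b < pos c" "R u b" "R u c" "R v b"
    for u v b c
  proof (rule ccontr)
    assume "\<not> R v c"
    then have "ladder pos 2 (\<lambda>a. if a = 0 then u else v) (\<lambda>a. if a = 0 then b else c)"
      using * by (auto simp: ladder_def less_2_cases_iff all_less_two)
    then have base: "\<exists>i j. ladder pos 2 i j" by blast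
    have ex: "\<exists>i j. ladder pos (2 + m) i j" for m
    proof (induction m)
      case (Suc m)
      then obtain i j where "ladder pos (2 + m) i j" by blast
      from ladder_extend[OF lex nosp _ this] show ?case by simp
    qed (use base in simp)
    obtain i j where lad: "ladder pos (2 + card V) i j" using ex by blast
    have "a \<le> pos (i a)" if "a < 2 + card V" for a
      using that
    proof (induction a)
      case (Suc a)
      then have "pos (i a) < pos (i (Suc a))" using lad by (simp add: ladder_def)
      then show ?case using Suc by simp
    qed simp
    then have "card V \<le> pos (i (card V))" by simp
    moreover have "i (card V) \<in> V" using lad by (simp add: ladder_def)
    ultimately show False using rng by fastforce
  qed
  then show thesis using that[OF inj] by blast
qed

section \<open>Greedy packings\<close>

text \<open>
  The induction removes from the set \<open>U\<close> of vertices still to be dominated the first vertex \<open>u\<close> and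
  everything near the last vertex \<open>c\<close> near \<open>u\<close>. A remaining vertex that shares a neighbour \<open>b\<close> with
  \<open>u\<close> would, by the property of the ordering, be near \<open>c\<close> too and hence have been removed.
\<close>

lemma greedy_packing:
  fixes pos :: "'a \<Rightarrow> nat"
  assumes inj: "inj_on pos V"
    and greedy: "\<And>u v b c. \<lbrakk>u \<in> V; v \<in> V; b \<in> V; c \<in> V; pos u < pos v; pos b < pos c; R u b; R u c; R v b\<rbrakk> \<Longrightarrow> R v c"
    and "U \<subseteq> V"
  shows "\<exists>D P. D \<subseteq> V \<and> P \<subseteq> U \<and> card D \<le> card P \<and> (\<forall>u\<in>U. \<exists>c\<in>D. R u c) \<and>
    (\<forall>p\<in>P. \<forall>q\<in>P. \<forall>b\<in>V. R p b \<longrightarrow> R q b \<longrightarrow> p = q)"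
proof -
  have "finite U" using \<open>U \<subseteq> V\<close> finite_V finite_subset by blast
  then show ?thesis using \<open>U \<subseteq> V\<close>
  proof (induction U rule: finite_psubset_induct)
    case (psubset U)
    show ?case
    proof (cases "U = {}")
      case True
      then show ?thesis by (intro exI[of _ "{}"]) auto
    next
      case False
      then have "Min (pos ` U) \<in> pos ` U" using psubset.hyps by (intro Min_in) auto
      then obtain u where u: "u \<in> U" "pos u = Min (pos ` U)" by auto
      have umin: "pos u \<le> pos v" if "v \<in> U" for v using that u psubset.hyps by simp
      define N where "N = {b\<in>V. R u b}"
      have N: "finite N" "u \<in> N" using finite_V u psubset.prems rel_refl by (auto simp: N_def)
      then have "Max (pos ` N) \<in> pos ` N" by (intro Max_in) auto
      then obtain c where c: "c \<in> N" "pos c = Max (pos ` N)" by auto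
      have cmax: "pos b \<le> pos c" if "b \<in> N" for b using that c N by simp
      define U' where "U' = {v\<in>U. \<not> R v c}"
      have "U' \<subset> U" using u(1) c by (auto simp: U'_def N_def)
      moreover from this have "U' \<subseteq> V" using psubset.prems by blast
      ultimately obtain D P where DP: "D \<subseteq> V" "P \<subseteq> U'" "card D \<le> card P"
        "\<forall>u\<in>U'. \<exists>c\<in>D. R u c" "\<forall>p\<in>P. \<forall>q\<in>P. \<forall>b\<in>V. R p b \<longrightarrow> R q b \<longrightarrow> p = q"
        using psubset.IH by metis
      have fin: "finite D" "finite P"
        using finite_subset[OF DP(1) finite_V] finite_subset[of P U] DP(2) psubset.hyps \<open>U' \<subset> U\<close> by auto
      have uP: "u \<notin> P" using DP c by (auto simp: U'_def N_def)
      have sep: False if "p \<in> P" "b \<in> V" "R u b" "R p b" for p b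
      proof -
        have p: "p \<in> U" "\<not> R p c" using that DP by (auto simp: U'_def)
        then have "pos u < pos p"
          using umin[of p] inj_onD[OF inj, of u p] uP that(1) u psubset.prems by (auto simp: le_less)
        moreover have "pos b < pos c"
          using cmax[of b] inj_onD[OF inj, of b c] that p c by (auto simp: N_def le_less)
        ultimately show False
          using greedy[of u p b c] that p u c psubset.prems by (auto simp: N_def)
      qed
      show ?thesis
      proof (intro exI conjI)
        show "card (insert c D) \<le> card (insert u P)"
          using DP(3) fin uP by (simp add: card_insert_if)
        show "insert c D \<subseteq> V" "insert u P \<subseteq> U"
          using DP c u \<open>U' \<subset> U\<close> by (auto simp: N_def)
        show "\<forall>u\<in>U. \<exists>c\<in>insert c D. R u c" using DP(4) by (auto simp: U'_def)
        show "\<forall>p\<in>insert u P. \<forall>q\<in>insert u P. \<forall>b\<in>V. R p b \<longrightarrow> R q b \<longrightarrow> p = q"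
          using DP(5) sep by blast
      qed
    qed
  qed
qed

lemma dominating_packing:
  assumes "\<nexists>n z. special_cycle R n z"
  shows "\<exists>D P. D \<subseteq> V \<and> P \<subseteq> V \<and> card D \<le> card P \<and> (\<forall>u\<in>V. \<exists>c\<in>D. R u c) \<and>
    (\<forall>p\<in>P. \<forall>q\<in>P. \<forall>b\<in>V. R p b \<longrightarrow> R q b \<longrightarrow> p = q)"
proof (rule greedy_order[OF assms])
  fix pos :: "'a \<Rightarrow> nat"
  assume *: "inj_on pos V"
    "\<And>u v b c. \<lbrakk>u \<in> V; v \<in> V; b \<in> V; c \<in> V; pos u < pos v; pos b < pos c; R u b; R u c; R v b\<rbrakk> \<Longrightarrow> R v c"
  show ?thesis
    by (rule greedy_packing[OF * order_refl])
qed

end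

section \<open>Cycles in strongly chordal graphs\<close>

context pair_graph
begin

definition near :: "'a \<Rightarrow> 'a \<Rightarrow> bool" where
  "near x y \<longleftrightarrow> y \<in> closed_nbhd G x"

lemma near_iff: "near x y \<longleftrightarrow> x = y \<or> (x, y) \<in> parcs G"
  by (auto simp: near_def closed_nbhd_def open_nbhd_def)

lemma near_tolerance: "tolerance (pverts G) near"
  by unfold_locales (auto simp: near_iff pair_finite_verts intro: arcs_symmetric)

lemma near_sym: "near x y \<longleftrightarrow> near y x"
  by (auto simp: near_iff intro: arcs_symmetric)

definition arcs_of :: "(nat \<Rightarrow> 'a) \<Rightarrow> nat \<Rightarrow> ('a \<times> 'a) list" where
  "arcs_of z n = map (\<lambda>t. (z t, z (Suc t))) [0..<n]"

lemma awalk_arcs_of: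
  assumes "\<And>t. t < n \<Longrightarrow> (z t, z (Suc t)) \<in> parcs G" and "z 0 \<in> pverts G"
  shows "awalk (z 0) (arcs_of z n) (z n) \<and> awalk_verts (z 0) (arcs_of z n) = map z [0..<Suc n]"
  using assms
proof (induction n)
  case 0
  then show ?case by (simp add: arcs_of_def awalk_simps)
next
  case (Suc n)
  have "arcs_of z (Suc n) = arcs_of z n @ [(z n, z (Suc n))]" by (simp add: arcs_of_def)
  then show ?case using Suc
    by (auto simp: awalk_simps awalk_verts_conv arcs_of_def intro: wellformed')
qed

lemma cycle_arcs_of:
  assumes "\<And>t. t < n \<Longrightarrow> (z t, z (Suc t)) \<in> parcs G" and "z n = z 0"
    and "inj_on z {..<n}" and "0 < n"
  shows "cycle (arcs_of z n)" "length (arcs_of z n) = n" "\<And>t. t < n \<Longrightarrow> fst (arcs_of z n ! t) = z t"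
proof -
  have "z 0 \<in> pverts G" using assms(1)[of 0] assms(4) by (auto intro: wellformed')
  with assms have "awalk (z 0) (arcs_of z n) (z 0)"
    "awalk_verts (z 0) (arcs_of z n) = map z [0..<Suc n]"
    using awalk_arcs_of[of n z] by auto
  moreover have "distinct (tl (map z [0..<Suc n]))"
  proof -
    have "tl (map z [0..<Suc n]) = map z [Suc 0..<n] @ [z 0]"
      using assms(2,4) by (simp add: upt_rec[of 0 n])
    moreover have "inj_on z {Suc 0..<n}"
      by (rule inj_on_subset[OF assms(3)]) auto
    moreover have "z 0 \<notin> z ` {Suc 0..<n}"
    proof
      assume "z 0 \<in> z ` {Suc 0..<n}"
      then obtain t where "t \<in> {Suc 0..<n}" "z 0 = z t" by blast
      then show False using inj_onD[OF assms(3), of 0 t] by auto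
    qed
    ultimately show ?thesis by (simp add: distinct_map)
  qed
  ultimately show "cycle (arcs_of z n)" using assms(4) unfolding cycle_def
    by (metis arcs_of_def length_0_conv length_map length_upt less_numeral_extra(3) minus_nat.diff_0)
  show "length (arcs_of z n) = n" "\<And>t. t < n \<Longrightarrow> fst (arcs_of z n ! t) = z t"
    by (simp_all add: arcs_of_def)
qed

text \<open>The chord is given by an ordered pair of positions that are not next to each other on the
  cycle, the form in which it is refuted below.\<close>

lemma chordal_no_hole:
  assumes "chordal G" and n: "4 \<le> n"
    and edge: "\<And>t. t < n \<Longrightarrow> (z t, z (Suc t)) \<in> parcs G" and close: "z n = z 0" and inj: "inj_on z {..<n}"
  obtains s t where "s < t" "t < n" "s + 1 < t" "\<not> (s = 0 \<and> t = n - 1)" "(z s, z t) \<in> parcs G"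
proof -
  note c = cycle_arcs_of[OF edge close inj]
  have "\<exists>d. has_chord_at_dist G p d" if "cycle p" "4 \<le> length p" for p
    using \<open>chordal G\<close> that by (simp add: chordal_def)
  from this[OF c(1)] obtain d where "has_chord_at_dist G (arcs_of z n) d" using n c(2) by auto
  then obtain s t where st: "s < n" "t < n" "cycle_dist n s t > 1" "(z s, z t) \<in> parcs G"
    unfolding has_chord_at_dist_def using n c(2,3) by auto
  show thesis
  proof (cases "s < t")
    case True
    then show ?thesis by (intro that[of s t]) (use st in \<open>auto simp: cycle_dist_def\<close>)
  next
    case False
    moreover have "s \<noteq> t" using st by (auto simp: cycle_dist_def)
    ultimately show ?thesis
      by (intro that[of t s]) (use st arcs_symmetric in \<open>auto simp: cycle_dist_def\<close>)
  qed
qed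

text \<open>
  In a chordal graph, two nonadjacent neighbours of \<open>v\<close> are not joined by a walk with interior
  outside \<open>N[v]\<close>: a shortest such walk would be an induced path and, together with \<open>v\<close>, a chordless
  cycle. Shortening is the induction; since consecutive vertices of a walk may coincide,
  repetitions are removed in the same way as chords.
\<close>

lemma chordal_walk_around:
  assumes "chordal G"
    and "\<And>t. t < m \<Longrightarrow> near (y t) (y (Suc t))" "near v (y 0)" "near v (y m)" "\<not> near (y 0) (y m)"
  shows "\<exists>t. 0 < t \<and> t < m \<and> near v (y t)"
  using assms(2-)
proof (induction m arbitrary: y rule: less_induct)
  case (less m)
  show ?case
  proof (rule ccontr)
    assume "\<not> ?thesis"
    then have no: "\<not> near v (y t)" if "0 < t" "t < m" for t using that by blast
    have m2: "2 \<le> m" using less.prems(1)[of 0] less.prems(4)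
      by (cases m; cases "m - 1") (auto simp: near_iff)
    have short: "\<not> near (y s) (y t)" if "s + 1 < t" "t \<le> m" for s t
    proof
      assume st: "near (y s) (y t)"
      define e where "e = t - s - 1"
      \<comment> \<open>the walk that jumps from position \<open>s\<close> to position \<open>t\<close>\<close>
      define y' where "y' r = (if r \<le> s then y r else y (r + e))" for r
      have e: "0 < e" "t = Suc (s + e)" using that by (auto simp: e_def)
      have "\<exists>r. 0 < r \<and> r < m - e \<and> near v (y' r)"
      proof (rule less.IH)
        show "m - e < m" using e that by auto
        fix r assume "r < m - e"
        then show "near (y' r) (y' (Suc r))"
          using st e less.prems(1)[of r] less.prems(1)[of "r + e"]
          by (cases "r = s") (auto simp: y'_def)
      next
        have "y' (m - e) = y m"
          using e that by (auto simp: y'_def)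
        then show "near v (y' (m - e))" "\<not> near (y' 0) (y' (m - e))" using less.prems
          by (auto simp: y'_def)
      qed (use less.prems in \<open>auto simp: y'_def\<close>)
      then obtain r where "0 < r" "r < m - e" "near v (y' r)" by blast
      moreover from this have "r < m" "r + e < m" by linarith+
      ultimately show False using no[of r] no[of "r + e"] by (auto simp: y'_def split: if_splits)
    qed
    have step: "y t \<noteq> y (Suc t)" if "t < m" for t
    proof
      assume eq: "y t = y (Suc t)"
      show False
      proof (cases t)
        case 0
        then show False using short[of 0 2] eq m2 less.prems(1)[of 1] by (simp add: numeral_2_eq_2)
      next
        case (Suc r)
        then show False using short[of r "Suc t"] eq that less.prems(1)[of r] by simp
      qed
    qed
    have neq: "y s \<noteq> y t" if "s < t" "t \<le> m" for s t
      using that short[of s t] step[of s] by (cases "t = Suc s") (auto simp: near_iff)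
    have vy: "v \<noteq> y t" if "t \<le> m" for t
    proof
      assume "v = y t"
      then show False
        using that no[of t] less.prems(2,3,4) near_sym[of "y 0" "y m"] near_iff[of v v]
        by (cases "t = 0 \<or> t = m") auto
    qed
    \<comment> \<open>the closed walk through the \<open>y t\<close> and back to \<open>y 0\<close> through \<open>v\<close>\<close>
    define z where "z t = (if t \<le> m then y t else if t = Suc m then v else y 0)" for t
    obtain s t where st: "s < t" "t < m + 2" "s + 1 < t" "\<not> (s = 0 \<and> t = m + 2 - 1)" "(z s, z t) \<in> parcs G"
    proof (rule chordal_no_hole[OF \<open>chordal G\<close>])
      show "4 \<le> m + 2" using m2 by simp
      show "(z t, z (Suc t)) \<in> parcs G" if "t < m + 2" for t
      proof -
        have "near (z t) (z (Suc t))" "z t \<noteq> z (Suc t)"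
          using that less.prems(1)[of t] less.prems(2,3) near_sym[of v "y m"] step[of t] vy[of 0] vy[of m]
          by (auto simp: z_def not_le less_Suc_eq)
        then show ?thesis by (simp add: near_iff)
      qed
      show "inj_on z {..<m + 2}"
      proof (rule linorder_inj_onI)
        fix s t assume "s < t" "s \<in> {..<m + 2}" "t \<in> {..<m + 2}"
        then show "z s \<noteq> z t" using neq[of s t] vy[of s] by (auto simp: z_def)
      qed auto
    qed (auto simp: z_def)
    show False
    proof (cases "t \<le> m")
      case True
      then show False using short[of s t] st by (auto simp: z_def near_iff)
    next
      case False
      then have "z t = v" "z s = y s" "0 < s" "s < m" using st by (auto simp: z_def)
      then show False using no[of s] st(5) near_sym[of "y s" v] by (auto simp: near_iff)
    qed
  qed
qed

text \<open>
  Coincidences on a special cycle can only be between consecutive members: two rows differ because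
  they meet different columns, and a row that equals a column is incident with it. If
  \<open>z s = z (Suc s) = v\<close>, then as a row and as a column \<open>v\<close> is near only itself and the two members
  next to this pair, so the walk \<open>z (s + 2), \<dots>, z (s + n - 1)\<close> contradicts chordality. If there is no coincidence,
  the special cycle is a cycle of the graph whose chords all join vertices at even distance.
\<close>

lemma strongly_chordal_no_special_cycle:
  assumes sc: "strongly_chordal G" shows "\<nexists>n z. special_cycle near n z"
proof
  assume "\<exists>n z. special_cycle near n z"
  then obtain n and z :: "nat \<Rightarrow> 'a" where n: "even n" "6 \<le> n" and per: "\<And>s. z (s + n) = z s"
    and adj: "\<And>s d. odd d \<Longrightarrow> d < n \<Longrightarrow> near (z s) (z (s + d)) \<longleftrightarrow> d = 1 \<or> d = n - 1"
    unfolding special_cycle_def by blast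
  have near_odd: "near (z s) (z t) \<longleftrightarrow> t - s = 1 \<or> t - s = n - 1"
    if "s < t" "t < s + n" "odd (t - s)" for s t
    using adj[of "t - s" s] that by auto
  have noconsec: "z s \<noteq> z (Suc s)" for s
  proof
    assume eq: "z s = z (Suc s)"
    have "\<exists>t. 0 < t \<and> t < n - 3 \<and> near (z s) (z (s + 2 + t))"
    proof (rule chordal_walk_around)
      show "chordal G" using sc by (simp add: strongly_chordal_def)
      show "near (z (s + 2 + t)) (z (s + 2 + Suc t))" for t
        using adj[of 1 "s + 2 + t"] n by simp
      show "near (z s) (z (s + 2 + 0))" using adj[of 1 "Suc s"] n eq by simp
      have "s + 2 + (n - 3) = s + (n - 1)" using n by simp
      then show "near (z s) (z (s + 2 + (n - 3)))" using adj[of "n - 1" s] n by simp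
      show "\<not> near (z (s + 2 + 0)) (z (s + 2 + (n - 3)))"
        using near_odd[of "s + 2" "s + 2 + (n - 3)"] n by auto
    qed
    then obtain t where "0 < t" "t + 3 < n" "near (z s) (z (s + 2 + t))" by auto
    then show False
      using near_odd[of s "s + 2 + t"] near_odd[of "Suc s" "s + 2 + t"] n eq by (cases "odd t") auto
  qed
  have inj: "inj_on z {..<n}"
  proof (rule linorder_inj_onI)
    fix s t assume st: "s < t" "s \<in> {..<n}" "t \<in> {..<n}"
    show "z s \<noteq> z t"
    proof
      assume eq: "z s = z t"
      show False
      proof (cases "odd (t - s)")
        case True
        then have "t = Suc s \<or> t - s = n - 1" using near_odd[of s t] st eq by (auto simp: near_iff)
        then show False
        proof
          assume "t - s = n - 1"
          then have "s + n = Suc t" using st by auto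
          then show False using noconsec[of t] per[of s] eq by simp
        qed (use noconsec eq in blast)
      next
        case False
        \<comment> \<open>the common vertex is near the successors of both positions, which forces \<open>n = 4\<close>\<close>
        have "near (z t) (z (Suc t))" using near_odd[of t "Suc t"] n by simp
        then have "near (z s) (z (Suc t))" using eq by simp
        moreover have "Suc t \<noteq> s + n"
        proof
          assume "Suc t = s + n"
          then have "t - s = n - 1" using st by simp
          then show False using False n by simp
        qed
        ultimately have a: "t + 2 = s + n" using near_odd[of s "Suc t"] st False n by auto
        have "near (z (s + 1)) (z t)" using near_odd[of s "Suc s"] n near_sym eq by simp
        moreover have "t \<noteq> s + 1" using False by auto
        ultimately have "t = s + 2" using near_odd[of "s + 1" t] st False n a by auto
        then show False using a n by simp
      qed
    qed
  qed auto
  have edge: "(z t, z (Suc t)) \<in> parcs G" for t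
    using adj[of 1 t] noconsec[of t] n by (auto simp: near_iff)
  have "z n = z 0" "0 < n" using per[of 0] n by simp_all
  note c = cycle_arcs_of[OF edge this(1) inj this(2)]
  have "\<exists>d. odd d \<and> has_chord_at_dist G p d" if "cycle p" "even (length p)" "6 \<le> length p" for p
    using sc that by (simp add: strongly_chordal_def)
  from this[OF c(1)] obtain d where d: "odd d" "has_chord_at_dist G (arcs_of z n) d"
    using n c(2) by auto
  then obtain s t where st: "s < n" "t < n" "cycle_dist n s t = d" "(z s, z t) \<in> parcs G" and "d > 1"
    unfolding has_chord_at_dist_def c(2) using c(3) by auto
  have no: False if "s < t" "t < n" "cycle_dist n s t = d" "near (z s) (z t)" for s t
  proof -
    have dist: "min (t - s) (n - (t - s)) = d"
      using that by (simp add: cycle_dist_def)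
    have "odd (t - s)"
    proof
      assume "even (t - s)"
      moreover from this have "even (n - (t - s))" using n by simp
      ultimately show False using dist \<open>odd d\<close> unfolding min_def by (metis (full_types))
    qed
    then have "t - s = 1 \<or> t - s = n - 1" using near_odd[of s t] that by simp
    then show False using dist \<open>d > 1\<close> n by auto
  qed
  have "cycle_dist n t s = d"
    using st(3) unfolding cycle_dist_def max.commute[of t s] min.commute[of t s] .
  moreover have "near (z s) (z t)" using st(4) by (simp add: near_iff)
  moreover from this have "near (z t) (z s)" using near_sym by blast
  moreover have "s \<noteq> t" using st(3) \<open>d > 1\<close> by (auto simp: cycle_dist_def)
  ultimately show False using no[of s t] no[of t s] st by linarith
qed

section \<open>Domination and fractional domination\<close>

lemma closed_nbhd_subset: "x \<in> pverts G \<Longrightarrow> closed_nbhd G x \<subseteq> pverts G"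
  by (auto simp: closed_nbhd_def open_nbhd_def dest: in_arcsD2)

text \<open>Nearness is symmetric, so a set that meets every closed neighbourhood is dominating.\<close>

lemma domination_number_le_packing:
  assumes "strongly_chordal G"
  obtains P where "P \<subseteq> pverts G" "domination_number G \<le> card P"
    "\<And>p q. p \<in> P \<Longrightarrow> q \<in> P \<Longrightarrow> p \<noteq> q \<Longrightarrow> closed_nbhd G p \<inter> closed_nbhd G q = {}"
proof -
  interpret N: tolerance "pverts G" near by (rule near_tolerance)
  obtain D P where DP: "D \<subseteq> pverts G" "P \<subseteq> pverts G" "card D \<le> card P" "\<forall>u\<in>pverts G. \<exists>c\<in>D. near u c"
    "\<forall>p\<in>P. \<forall>q\<in>P. \<forall>b\<in>pverts G. near p b \<longrightarrow> near q b \<longrightarrow> p = q"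
    using N.dominating_packing[OF strongly_chordal_no_special_cycle[OF assms]] by blast
  have "dominating_set G D"
    unfolding dominating_set_def
  proof (intro conjI equalityI subsetI)
    fix u assume "u \<in> pverts G"
    then obtain c where "c \<in> D" "near u c" using DP(4) by blast
    then show "u \<in> (\<Union>c\<in>D. closed_nbhd G c)" using near_sym[of u c] by (auto simp: near_def)
  qed (use DP(1) closed_nbhd_subset in auto)
  then have "domination_number G \<le> card D"
    unfolding domination_number_def using dominating_sets(1) by (intro Min_le) auto
  then have card: "domination_number G \<le> card P" using DP(3) by linarith
  have disj: "closed_nbhd G p \<inter> closed_nbhd G q = {}" if "p \<in> P" "q \<in> P" "p \<noteq> q" for p q
  proof -
    have "b \<notin> closed_nbhd G q" if "b \<in> closed_nbhd G p" for b
    proof -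
      have "b \<in> pverts G" using closed_nbhd_subset \<open>p \<in> P\<close> DP(2) that by blast
      then show ?thesis using DP(5) that \<open>p \<in> P\<close> \<open>q \<in> P\<close> \<open>p \<noteq> q\<close> unfolding near_def by blast
    qed
    then show ?thesis by blast
  qed
  show thesis by (rule that[OF DP(2) card disj])
qed

text \<open>The weak half of linear programming duality: disjoint closed neighbourhoods use disjoint parts of
  the total weight.\<close>

lemma packing_le_total_weight:
  assumes w: "frac_dominating G w" and P: "P \<subseteq> pverts G"
    and disj: "\<And>p q. p \<in> P \<Longrightarrow> q \<in> P \<Longrightarrow> p \<noteq> q \<Longrightarrow> closed_nbhd G p \<inter> closed_nbhd G q = {}"
  shows "real (card P) \<le> total_weight G w"
proof -
  have finP: "finite P" by (rule finite_subset[OF P pair_finite_verts])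
  have fin: "finite (closed_nbhd G p)" if "p \<in> P" for p
    using finite_subset[OF closed_nbhd_subset pair_finite_verts, of p] P that by blast
  have nonneg: "0 \<le> w x" if "x \<in> pverts G" for x
    using w that by (simp add: frac_dominating_def)
  have one: "1 \<le> (\<Sum>x\<in>closed_nbhd G p. w x)" if "p \<in> P" for p
    using w P that unfolding frac_dominating_def by blast
  have "real (card P) = (\<Sum>p\<in>P. 1)" by simp
  also have "\<dots> \<le> (\<Sum>p\<in>P. \<Sum>x\<in>closed_nbhd G p. w x)"
    by (rule sum_mono) (rule one)
  also have "\<dots> = (\<Sum>x\<in>(\<Union>p\<in>P. closed_nbhd G p). w x)"
    by (rule sum.UNION_disjoint[symmetric]) (use finP fin disj in blast)+
  also have "\<dots> \<le> total_weight G w"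
    unfolding total_weight_def
  proof (rule sum_mono2[OF pair_finite_verts])
    show "(\<Union>p\<in>P. closed_nbhd G p) \<subseteq> pverts G" using closed_nbhd_subset P by blast
  qed (use nonneg in blast)
  finally show ?thesis .
qed

end

theorem corollary4p12:
  fixes G :: "'a pair_pre_digraph"
  assumes "pair_graph G"
    and "strongly_chordal G"
  shows "frac_eternal_domination_number G \<ge> real (domination_number G)"
proof -
  interpret pair_graph G by fact
  show ?thesis
  proof (rule domination_number_le_packing[OF assms(2)])
    fix P
    assume P: "P \<subseteq> pverts G" "domination_number G \<le> card P"
      "\<And>p q. p \<in> P \<Longrightarrow> q \<in> P \<Longrightarrow> p \<noteq> q \<Longrightarrow> closed_nbhd G p \<inter> closed_nbhd G q = {}"
    show ?thesis
      unfolding frac_eternal_domination_number_def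
    proof (rule cInf_greatest[OF eternally_frac_dominated_set(1)])
      fix S assume "S \<in> {S. eternally_frac_dominated G S}"
      then obtain w where "frac_dominating G w" "total_weight G w \<le> S"
        by (auto simp: eternally_frac_dominated_def)
      then show "real (domination_number G) \<le> S"
        using packing_le_total_weight[OF _ P(1,3), of w] P(2) by linarith
    qed
  qed
qed

end
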